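(* Let $h:[-1,1]\to\mathbb{R}$ be continuous on $[-1,1]$ (in particular finite at $1$), twelve times differentiable on $(-1,1)$ with $h^{(12)}(t)\ge0$ for $t\in(-1,1)$. Let $T_1=(-\frac13,-\frac16)\cup(\frac16,\frac13)$. Then for every $T_1$-avoiding spherical $11$-design $C\subset\mathbb{S}^{47}$ with $|C|=52\,416\,000$, \[ \mathcal{E}^h(C)\le \mathcal{E}^h(C^* ), \] where $C^*$ is any of the four codes formed by the minimal vectors (normalized to unit length) of the even unimodular extremal lattices $P_{48p},P_{48q},P_{48m},P_{48n}$ in $\mathbb{R}^{48}$; i.e. these four codes are universally optimal with respect to maximal $h$-energy in this class.
   Context: $\mathbb{S}^{47}$ is the unit sphere in $\mathbb{R}^{48}$. A spherical code is a finite set $C\subset\mathbb{S}^{47}$ with $|C|\ge2$; $I(C)=\{x\cdot y:x,y\in C,x\ne y\}$; $C$ is $T$-avoiding if $I(C)\cap T=\emptyset$. The $h$-energy is $\mathcal{E}^h(C)=\frac1{|C|}\sum_{x,y\in C,x\ne y}h(x\cdot y)$. A spherical $11$-design is a code $C$ with $\int_{\mathbb{S}^{47}}p\,d\sigma=\frac1{|C|}\sum_{x\in C}p(x)$ for all polynomials $p$ of total degree at most $11$, $\sigma$ the normalized surface measure. $P_{48p},P_{48q},P_{48m}$ are the extremal even unimodular lattices in dimension 48 described by Conway–Sloane, and $P_{48n}$ is the fourth one found by Nebe; each has $52\,416\,000$ minimal vectors, and the normalized minimal vectors form a $T_1$-avoiding spherical $11$-design whose $h$-energy equals $36848(h(-\frac12)+h(\frac12))+1678887(h(-\frac13)+h(\frac13))+12608784(h(-\frac16)+h(\frac16))+23766960h(0)+h(-1)$.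 *)

theory Defs
  imports "HOL-Analysis.Analysis" "HOL-Probability.Probability"
begin

text \<open>Normalized surface measure on the unit sphere of real^'n, realised as the
  push-forward of the uniform probability measure on the unit ball under radial
  projection x \<mapsto> x / |x| (the cone-measure construction of normalized surface measure).\<close>
definition sphere_measure :: "(real ^ 'n) measure" where
  "sphere_measure = distr (uniform_measure lborel (ball 0 1)) borel (\<lambda>x. x /\<^sub>R norm x)"

definition poly_fun_deg_le :: "nat \<Rightarrow> (real ^ 'n \<Rightarrow> real) \<Rightarrow> bool" where
  "poly_fun_deg_le k p \<longleftrightarrow>
     (\<exists>A c. finite (A :: ('n \<Rightarrow> nat) set) \<and> (\<forall>\<alpha>\<in>A. (\<Sum>i\<in>UNIV. \<alpha> i) \<le> k) \<and>
        p = (\<lambda>x. \<Sum>\<alpha>\<in>A. c \<alpha> * (\<Prod>i\<in>UNIV. (x $ i) ^ \<alpha> i)))"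

definition spherical_code :: "(real ^ 'n) set \<Rightarrow> bool" where
  "spherical_code C \<longleftrightarrow> finite C \<and> card C \<ge> 2 \<and> C \<subseteq> sphere 0 1"

definition inner_products :: "(real ^ 'n) set \<Rightarrow> real set" where
  "inner_products C = {x \<bullet> y | x y. x \<in> C \<and> y \<in> C \<and> x \<noteq> y}"

definition avoiding :: "real set \<Rightarrow> (real ^ 'n) set \<Rightarrow> bool" where
  "avoiding T C \<longleftrightarrow> inner_products C \<inter> T = {}"

definition spherical_design :: "nat \<Rightarrow> (real ^ 'n) set \<Rightarrow> bool" where
  "spherical_design t C \<longleftrightarrow> spherical_code C \<and>
     (\<forall>p. poly_fun_deg_le t p \<longrightarrow>
        integral\<^sup>L sphere_measure p = (1 / real (card C)) * (\<Sum>x\<in>C. p x))"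

definition h_energy :: "(real \<Rightarrow> real) \<Rightarrow> (real ^ 'n) set \<Rightarrow> real" where
  "h_energy h C = (1 / real (card C)) * (\<Sum>x\<in>C. \<Sum>y\<in>C - {x}. h (x \<bullet> y))"

definition T1 :: "real set" where
  "T1 = {-1/3<..<-1/6} \<union> {1/6<..<1/3}"

text \<open>The h-energy of the normalized minimal vectors of P48p, P48q, P48m, P48n
  (common value, as given by their distance distribution).\<close>
definition E_star :: "(real \<Rightarrow> real) \<Rightarrow> real" where
  "E_star h = 36848 * (h (-1/2) + h (1/2)) + 1678887 * (h (-1/3) + h (1/3))
     + 12608784 * (h (-1/6) + h (1/6)) + 23766960 * h 0 + h (-1)"

end

theory Submission
  imports Defs "HOL-Computational_Algebra.Polynomial"
begin

text \<open>
  Linear programming bound. Let \<open>H\<close> be the Hermite interpolant of \<open>h\<close> of degree at most 11 that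
  agrees with \<open>h\<close> at \<open>\<plusminus>1, \<plusminus>1/2, \<plusminus>1/3, \<plusminus>1/6, 0\<close> and to first order at \<open>\<plusminus>1/2, 0\<close>. Its
  error is a nonnegative multiple of
  \<open>(t\<^sup>2 - 1) (t\<^sup>2 - 1/4)\<^sup>2 t\<^sup>2 (t\<^sup>2 - 1/9) (t\<^sup>2 - 1/36)\<close>, which is nonpositive on
  \<open>[-1, 1]\<close> outside \<open>T1\<close>, so \<open>h \<le> H\<close> at all inner products of the code. The energy of \<open>H\<close>
  depends only on the moments of the sphere: it is the same for every 11-design of the given
  size, and equals \<open>E_star H = E_star h\<close> because all inner products occurring in \<open>E_star\<close> are
  interpolation nodes. The moments follow from rotation invariance alone.
\<close>

section \<open>Lagrange and Hermite interpolation\<close>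

lemma interpolating_poly_exists:
  fixes f :: "'a::field \<Rightarrow> 'a"
  assumes "finite S" "S \<noteq> {}"
  shows "\<exists>p. degree p < card S \<and> (\<forall>x\<in>S. poly p x = f x)"
  using assms
proof (induction rule: finite_ne_induct)
  case (singleton x)
  show ?case by (rule exI[of _ "[:f x:]"]) simp
next
  case (insert x S)
  then obtain p where p: "degree p < card S" "\<forall>y\<in>S. poly p y = f y" by blast
  define w where "w = (\<Prod>y\<in>S. [:-y, 1:])"
  have w: "degree w = card S" "poly w x \<noteq> 0" "\<forall>y\<in>S. poly w y = 0"
    using insert by (auto simp: w_def degree_prod_eq_sum_degree poly_prod)
  \<comment> \<open>Newton's form: \<open>w\<close> vanishes on \<open>S\<close>, so adding a
    multiple of it corrects the value at \<open>x\<close> without disturbing the others.\<close>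
  let ?q = "p + smult ((f x - poly p x) / poly w x) w"
  have "degree ?q \<le> card S"
    using p w by (intro degree_add_le) (auto intro: le_trans[OF degree_smult_le])
  moreover have "\<forall>y\<in>insert x S. poly ?q y = f y"
    using p w by auto
  ultimately show ?case
    using insert by (intro exI[of _ ?q]) auto
qed

text \<open>The nodal polynomial \<open>w\<close> of \<open>S\<close> has simple zeros. Adding
  \<open>w * q\<close> therefore keeps the values on \<open>S\<close> and shifts the derivative at a
  node \<open>x\<close> by \<open>w'(x) q(x)\<close> with \<open>w'(x)\<close> nonzero, so
  \<open>q\<close> has only to interpolate suitable values on \<open>D\<close>.\<close>

lemma Hermite_poly_exists:
  fixes f f' :: "real \<Rightarrow> real"
  assumes "finite S" "D \<subseteq> S" "D \<noteq> {}"
  shows "\<exists>p. degree p < card S + card D \<and> (\<forall>x\<in>S. poly p x = f x)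
           \<and> (\<forall>x\<in>D. poly (pderiv p) x = f' x)"
proof -
  have fD: "finite D" and S0: "S \<noteq> {}" using assms finite_subset by auto
  obtain p where p: "degree p < card S" "\<forall>x\<in>S. poly p x = f x"
    using interpolating_poly_exists[OF assms(1) S0] by blast
  define w where "w = (\<Prod>y\<in>S. [:-y, 1:])"
  have w: "degree w = card S" "\<forall>y\<in>S. poly w y = 0"
    using assms by (auto simp: w_def degree_prod_eq_sum_degree poly_prod)
  have w': "poly (pderiv w) x \<noteq> 0" if "x \<in> S" for x
  proof -
    have "w = [:-x, 1:] * (\<Prod>y\<in>S - {x}. [:-y, 1:])"
      using assms that by (simp add: w_def prod.remove)
    then have "poly (pderiv w) x = poly (\<Prod>y\<in>S - {x}. [:-y, 1:]) x"
      by (simp only: pderiv_mult) (simp add: pderiv_pCons)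
    then show ?thesis using assms by (simp add: poly_prod)
  qed
  obtain q where q: "degree q < card D"
      "\<forall>x\<in>D. poly q x = (f' x - poly (pderiv p) x) / poly (pderiv w) x"
    using interpolating_poly_exists[OF fD assms(3),
      of "\<lambda>x. (f' x - poly (pderiv p) x) / poly (pderiv w) x"] by blast
  have "degree (w * q) < card S + card D"
    using degree_mult_le[of w q] w q by linarith
  then have "degree (p + w * q) < card S + card D"
    using p by (intro degree_add_less) auto
  moreover have "poly (pderiv (p + w * q)) x = f' x" if "x \<in> D" for x
    using that w w'[of x] q assms by (auto simp: pderiv_add pderiv_mult)
  ultimately show ?thesis
    using p w by (intro exI[of _ "p + w * q"]) auto
qed

section \<open>Rolle's theorem and the error of Hermite interpolation\<close>

lemma Rolle_zeros:
  fixes f f' :: "real \<Rightarrow> real"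
  assumes "finite Z" "Z \<subseteq> {a..b}" "\<forall>z\<in>Z. f z = 0"
    and cont: "continuous_on {a..b} f"
    and der: "\<And>x. x \<in> {a<..<b} \<Longrightarrow> (f has_real_derivative f' x) (at x)"
  shows "\<exists>Y. finite Y \<and> Y \<subseteq> {a<..<b} \<and> Y \<inter> Z = {} \<and> Suc (card Y) \<ge> card Z
    \<and> (\<forall>y\<in>Y. f' y = 0)"
proof -
  \<comment> \<open>The added clause \<open>y < z\<close> keeps \<open>Y\<close> below
    \<open>Max Z\<close>. A Rolle point between \<open>Max Z\<close> and a new largest zero is then
    a new element of \<open>Y\<close> and misses all zeros.\<close>
  have "\<exists>Y. finite Y \<and> Y \<subseteq> {a<..<b} \<and> Y \<inter> Z = {} \<and> Suc (card Y) \<ge> card Z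
    \<and> (\<forall>y\<in>Y. f' y = 0 \<and> (\<exists>z\<in>Z. y < z))"
    using assms(1-3)
  proof (induction rule: finite_linorder_max_induct)
    case empty
    show ?case by (intro exI[of _ "{}"]) auto
  next
    case (insert x Z)
    show ?case
    proof (cases "Z = {}")
      case True
      then show ?thesis by (intro exI[of _ "{}"]) auto
    next
      case False
      define m where "m = Max Z"
      have m: "m \<in> Z" "\<And>z. z \<in> Z \<Longrightarrow> z \<le> m" using insert False by (auto simp: m_def)
      have mx: "m < x" "a \<le> m" "x \<le> b" using insert m by auto
      obtain Y where Y: "finite Y" "Y \<subseteq> {a<..<b}" "Y \<inter> Z = {}" "card Z \<le> Suc (card Y)"
          "\<forall>y\<in>Y. f' y = 0 \<and> (\<exists>z\<in>Z. y < z)"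
        using insert by auto
      have Ym: "y < m" if "y \<in> Y" for y
        using Y(5) m(2) that by (meson order_less_le_trans)
      \<comment> \<open>\<open>Rolle_deriv\<close> speaks of Frechet derivatives; evaluating the
        zero map at 1 gives \<open>f' y = 0\<close>.\<close>
      have "\<exists>y. m < y \<and> y < x \<and> (\<lambda>v. f' y * v) = (\<lambda>v. 0)"
      proof (rule Rolle_deriv[OF mx(1)])
        show "f m = f x" using insert m by simp
        show "continuous_on {m..x} f"
          using mx by (intro continuous_on_subset[OF cont]) auto
        show "(f has_derivative (\<lambda>v. f' y * v)) (at y)" if "m < y" "y < x" for y
          using der[of y] that mx by (simp add: has_field_derivative_def)
      qed
      then obtain y where y: "m < y" "y < x" "f' y = 0"
        by (metis mult.right_neutral)
      have "y \<notin> Y" using Ym y by force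
      moreover have "insert y Y \<inter> insert x Z = {}"
        using Y y m mx Ym by force
      moreover have "x \<notin> Z" using insert by auto
      moreover have "insert y Y \<subseteq> {a<..<b}" using Y y mx by auto
      moreover have "\<forall>v\<in>insert y Y. f' v = 0 \<and> (\<exists>z\<in>insert x Z. v < z)"
        using Y(5) y by auto
      ultimately show ?thesis
        using Y insert(1) by (intro exI[of _ "insert y Y"]) simp
    qed
  qed
  then show ?thesis by blast
qed

text \<open>Each differentiation costs at most one zero, so the induction passes to the shifted
  family \<open>F (Suc k)\<close>.\<close>

lemma iterated_Rolle:
  fixes F :: "nat \<Rightarrow> real \<Rightarrow> real"
  assumes "finite Z" "Z \<subseteq> {a<..<b}" "\<forall>z\<in>Z. F 0 z = 0" "card Z > n"
    and der: "\<And>k x. k < n \<Longrightarrow> x \<in> {a<..<b} \<Longrightarrow> (F k has_real_derivative F (Suc k) x) (at x)"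
  shows "\<exists>x\<in>{a<..<b}. F n x = 0"
  using assms
proof (induction n arbitrary: F Z)
  case 0
  then have "Z \<noteq> {}" by auto
  then show ?case using 0 by blast
next
  case (Suc n)
  have Z0: "Z \<noteq> {}" using Suc by auto
  \<comment> \<open>Nothing is assumed at \<open>a\<close> and \<open>b\<close>, so Rolle is applied
    between the extreme zeros, where \<open>F 0\<close> is differentiable.\<close>
  define u v where "u = Min Z" and "v = Max Z"
  have uv: "u \<in> Z" "v \<in> Z" "Z \<subseteq> {u..v}"
    using Suc(2) Z0 by (auto simp: u_def v_def)
  have ab: "a < u" "v < b" using uv Suc(3) by auto
  have d0: "(F 0 has_real_derivative F 1 x) (at x)" if "x \<in> {u..v}" for x
    using Suc(6)[of 0 x] that ab by auto
  have "\<exists>Y. finite Y \<and> Y \<subseteq> {u<..<v} \<and> Y \<inter> Z = {} \<and> Suc (card Y) \<ge> card Z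
    \<and> (\<forall>y\<in>Y. F 1 y = 0)"
  proof (rule Rolle_zeros[OF Suc(2) uv(3) Suc(4)])
    show "continuous_on {u..v} (F 0)"
      using d0 by (meson DERIV_continuous_on has_field_derivative_at_within)
  qed (use d0 in auto)
  then obtain Y where Y: "finite Y" "Y \<subseteq> {u<..<v}" "Suc (card Y) \<ge> card Z" "\<forall>y\<in>Y. F 1 y = 0"
    by blast
  have "\<exists>x\<in>{a<..<b}. (\<lambda>k. F (Suc k)) n x = 0"
    by (rule Suc.IH[of Y]) (use Y ab Suc(5,6) in auto)
  then show ?case by simp
qed

text \<open>Error term of Hermite interpolation: at a point \<open>t\<close> off the nodes, subtract the
  multiple \<open>K\<close> of the nodal polynomial \<open>W\<close> that makes \<open>t\<close> a further zero; iterated Rolle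
  then gives \<open>K = f\<^sup>(\<^sup>n\<^sup>)(\<xi>) / n!\<close>.\<close>
lemma Hermite_interpolation_error:
  fixes F :: "nat \<Rightarrow> real \<Rightarrow> real" and H W :: "real poly"
  assumes S: "finite S" "S \<subseteq> {a..b}" and D: "D \<subseteq> S" "D \<subseteq> {a<..<b}"
    and n: "n = card S + card D" "0 < n"
    and cont: "continuous_on {a..b} (F 0)"
    and der: "\<And>k x. k < n \<Longrightarrow> x \<in> {a<..<b} \<Longrightarrow> (F k has_real_derivative F (Suc k) x) (at x)"
    and nonneg: "\<And>x. x \<in> {a<..<b} \<Longrightarrow> F n x \<ge> 0"
    and H: "degree H < n" "\<forall>x\<in>S. poly H x = F 0 x" "\<forall>x\<in>D. poly (pderiv H) x = F 1 x"
    and W: "W = (\<Prod>y\<in>S. [:-y, 1:]) * (\<Prod>y\<in>D. [:-y, 1:])"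
    and t: "t \<in> {a..b}" "poly W t \<le> 0"
  shows "F 0 t \<le> poly H t"
proof (cases "t \<in> S")
  case True
  then show ?thesis using H by simp
next
  case False
  have fD: "finite D" using S(1) D(1) by (rule rev_finite_subset)
  have tD: "t \<notin> D" using False D by auto
  have W0: "poly W t \<noteq> 0"
    using False tD S fD by (simp add: W poly_prod)
  have degW: "degree W = n"
    using S fD by (simp add: W n degree_mult_eq degree_prod_eq_sum_degree)
  have lcW: "coeff W n = 1"
    unfolding degW[symmetric] using W by (simp add: lead_coeff_mult lead_coeff_prod)
  have WS: "poly W y = 0" if "y \<in> S" for y
    using that S by (simp add: W poly_prod)
  have WD: "poly (pderiv W) y = 0" if "y \<in> D" for y
  proof -
    have "poly (\<Prod>y\<in>S. [:-y, 1:]) y = 0" "poly (\<Prod>y\<in>D. [:-y, 1:]) y = 0"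
      using that S D fD by (auto simp: poly_prod)
    then show ?thesis unfolding W pderiv_mult by simp
  qed
  define K where "K = (F 0 t - poly H t) / poly W t"
  define P where "P = H + smult K W"
  define G where "G k x = F k x - poly ((pderiv ^^ k) P) x" for k x
  have derG: "(G k has_real_derivative G (Suc k) x) (at x)" if "k < n" "x \<in> {a<..<b}" for k x
    unfolding G_def by (auto intro!: derivative_eq_intros der that)
  \<comment> \<open>The first Rolle step stands apart: nodes may be endpoints, where only continuity
    is known. The points \<open>Y\<close> it yields are interior.\<close>
  have "\<exists>Y. finite Y \<and> Y \<subseteq> {a<..<b} \<and> Y \<inter> insert t S = {}
      \<and> Suc (card Y) \<ge> card (insert t S) \<and> (\<forall>y\<in>Y. G 1 y = 0)"
  proof (rule Rolle_zeros)
    show "continuous_on {a..b} (G 0)"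
      unfolding G_def by (auto intro!: continuous_intros cont)
    show "\<forall>z\<in>insert t S. G 0 z = 0"
      using H W0 WS by (auto simp: G_def P_def K_def)
    show "(G 0 has_real_derivative G 1 x) (at x)" if "x \<in> {a<..<b}" for x
      using derG[of 0 x] n that by simp
  qed (use S t in auto)
  then obtain Y where Y: "finite Y" "Y \<subseteq> {a<..<b}" "Y \<inter> insert t S = {}"
      "Suc (card Y) \<ge> card (insert t S)" "\<forall>y\<in>Y. G 1 y = 0"
    by blast
  \<comment> \<open>\<open>Y\<close> avoids the nodes, so the double nodes \<open>D\<close> are
    additional zeros of \<open>G 1\<close>: at least \<open>n\<close> in all.\<close>
  have "card (Y \<union> D) = card Y + card D"
    using Y D fD by (intro card_Un_disjoint) auto
  then have card: "card (Y \<union> D) > n - 1"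
    using Y(4) n card_insert_disjoint[OF S(1) False] by linarith
  have "\<forall>y\<in>Y \<union> D. G 1 y = 0"
    using Y(5) H(3) WD by (auto simp: G_def P_def pderiv_add pderiv_smult)
  then have "\<exists>x\<in>{a<..<b}. (\<lambda>k. G (Suc k)) (n - 1) x = 0"
    by (intro iterated_Rolle[of "Y \<union> D"]) (use Y D fD card derG in auto)
  then obtain x where x: "x \<in> {a<..<b}" "G n x = 0"
    using n by auto
  \<comment> \<open>The \<open>n\<close>-th derivative kills \<open>H\<close> and turns the monic
    \<open>W\<close> into the constant \<open>n!\<close>.\<close>
  have "degree ((pderiv ^^ n) P) = 0"
    using H(1) degW unfolding degree_higher_pderiv P_def
    by (simp add: degree_add_le degree_smult_le less_imp_le)
  then have "poly ((pderiv ^^ n) P) x = coeff ((pderiv ^^ n) P) 0"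
    by (auto elim!: degree_eq_zeroE)
  also have "\<dots> = fact n * K"
    using H(1) lcW by (simp add: coeff_higher_pderiv P_def coeff_eq_0 pochhammer_fact)
  finally have "fact n * K = F n x" using x by (simp add: G_def)
  then have "fact n * K \<ge> 0" using nonneg[OF x(1)] by simp
  then have "K \<ge> 0" using fact_gt_zero[of n, where 'a = real] by (auto simp only: zero_le_mult_iff)
  moreover have "F 0 t - poly H t = K * poly W t" using W0 by (simp add: K_def)
  ultimately show ?thesis using t(2)
    using mult_nonneg_nonpos[of K "poly W t"] by linarith
qed

section \<open>Polynomial functions of bounded total degree\<close>

lemma poly_fun_deg_le_monomials:
  assumes "finite I" "\<And>i. i \<in> I \<Longrightarrow> (\<Sum>j\<in>UNIV. \<beta> i j) \<le> k"
  shows "poly_fun_deg_le k (\<lambda>x. \<Sum>i\<in>I. d i * (\<Prod>j\<in>UNIV. (x $ j) ^ \<beta> i j))"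
proof -
  \<comment> \<open>Distinct indices may share an exponent, so \<open>c\<close> adds up their
    coefficients. Sums and products of polynomial functions can then be indexed by disjoint unions
    and pairs.\<close>
  define c where "c \<gamma> = (\<Sum>i | i \<in> I \<and> \<beta> i = \<gamma>. d i)" for \<gamma>
  have "(\<Sum>i\<in>I. d i * (\<Prod>j\<in>UNIV. (x $ j) ^ \<beta> i j))
      = (\<Sum>\<gamma>\<in>\<beta> ` I. c \<gamma> * (\<Prod>j\<in>UNIV. (x $ j) ^ \<gamma> j))" for x
    by (subst sum.image_gen[OF assms(1), of _ \<beta>]) (auto simp: c_def sum_distrib_right intro!: sum.cong)
  then show ?thesis
    unfolding poly_fun_deg_le_def using assms
    by (intro exI[of _ "\<beta> ` I"] exI[of _ c]) auto
qed

lemma poly_fun_deg_leE: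
  assumes "poly_fun_deg_le k p"
  obtains A c where "finite A" "\<And>\<alpha>. \<alpha> \<in> A \<Longrightarrow> (\<Sum>i\<in>UNIV. \<alpha> i) \<le> k"
    "p = (\<lambda>x. \<Sum>\<alpha>\<in>A. c \<alpha> * (\<Prod>i\<in>UNIV. (x $ i) ^ \<alpha> i))"
  using assms unfolding poly_fun_deg_le_def by blast

lemma poly_fun_deg_le_mono: "poly_fun_deg_le k p \<Longrightarrow> k \<le> l \<Longrightarrow> poly_fun_deg_le l p"
  by (elim poly_fun_deg_leE, unfold poly_fun_deg_le_def) (blast intro: le_trans)

lemma poly_fun_deg_le_const: "poly_fun_deg_le k (\<lambda>x. a)"
  using poly_fun_deg_le_monomials[of "{()}" "\<lambda>_ _. 0" k "\<lambda>_. a"] by simp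

lemma poly_fun_deg_le_add:
  assumes "poly_fun_deg_le k p" "poly_fun_deg_le k q"
  shows "poly_fun_deg_le k (\<lambda>x. p x + q x)"
proof -
  obtain A c where A: "finite A" "\<And>\<alpha>. \<alpha> \<in> A \<Longrightarrow> (\<Sum>i\<in>UNIV. \<alpha> i) \<le> k"
      "p = (\<lambda>x. \<Sum>\<alpha>\<in>A. c \<alpha> * (\<Prod>i\<in>UNIV. (x $ i) ^ \<alpha> i))"
    using poly_fun_deg_leE[OF assms(1)] by blast
  obtain B d where B: "finite B" "\<And>\<alpha>. \<alpha> \<in> B \<Longrightarrow> (\<Sum>i\<in>UNIV. \<alpha> i) \<le> k"
      "q = (\<lambda>x. \<Sum>\<alpha>\<in>B. d \<alpha> * (\<Prod>i\<in>UNIV. (x $ i) ^ \<alpha> i))"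
    using poly_fun_deg_leE[OF assms(2)] by blast
  have "poly_fun_deg_le k (\<lambda>x. \<Sum>i\<in>A <+> B. (case i of Inl \<alpha> \<Rightarrow> c \<alpha> | Inr \<alpha> \<Rightarrow> d \<alpha>)
      * (\<Prod>j\<in>UNIV. (x $ j) ^ (case i of Inl \<alpha> \<Rightarrow> \<alpha> | Inr \<alpha> \<Rightarrow> \<alpha>) j))"
    using A B by (intro poly_fun_deg_le_monomials) auto
  then show ?thesis using A B by (simp add: sum.Plus)
qed

lemma poly_fun_deg_le_sum:
  assumes "\<And>i. i \<in> I \<Longrightarrow> poly_fun_deg_le k (p i)"
  shows "poly_fun_deg_le k (\<lambda>x. \<Sum>i\<in>I. p i x)"
  using assms
  by (induction I rule: infinite_finite_induct)
     (auto intro: poly_fun_deg_le_const poly_fun_deg_le_add)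

lemma poly_fun_deg_le_mult:
  assumes "poly_fun_deg_le k p" "poly_fun_deg_le l q"
  shows "poly_fun_deg_le (k + l) (\<lambda>x. p x * q x)"
proof -
  obtain A c where A: "finite A" "\<And>\<alpha>. \<alpha> \<in> A \<Longrightarrow> (\<Sum>i\<in>UNIV. \<alpha> i) \<le> k"
      "p = (\<lambda>x. \<Sum>\<alpha>\<in>A. c \<alpha> * (\<Prod>i\<in>UNIV. (x $ i) ^ \<alpha> i))"
    using poly_fun_deg_leE[OF assms(1)] by blast
  obtain B d where B: "finite B" "\<And>\<alpha>. \<alpha> \<in> B \<Longrightarrow> (\<Sum>i\<in>UNIV. \<alpha> i) \<le> l"
      "q = (\<lambda>x. \<Sum>\<alpha>\<in>B. d \<alpha> * (\<Prod>i\<in>UNIV. (x $ i) ^ \<alpha> i))"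
    using poly_fun_deg_leE[OF assms(2)] by blast
  have "poly_fun_deg_le (k + l) (\<lambda>x. \<Sum>i\<in>A \<times> B. (c (fst i) * d (snd i))
      * (\<Prod>j\<in>UNIV. (x $ j) ^ (fst i j + snd i j)))"
    using A B by (intro poly_fun_deg_le_monomials) (auto simp: sum.distrib intro: add_mono)
  then show ?thesis
    using A B by (simp add: sum_product sum.cartesian_product power_add prod.distrib
      case_prod_beta mult_ac)
qed

lemma poly_fun_deg_le_coord: "poly_fun_deg_le 1 (\<lambda>x. x $ i)"
proof -
  have "(\<Prod>j\<in>UNIV. (x $ j) ^ (if j = i then 1 else 0)) = x $ i" for x :: "real ^ 'a::_"
    by (subst prod.remove[of _ i]) auto
  then show ?thesis
    using poly_fun_deg_le_monomials[of "{()}" "\<lambda>_ j. if j = i then 1 else 0" 1 "\<lambda>_. 1"] by simp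
qed

lemma poly_fun_deg_le_inner: "poly_fun_deg_le 1 (\<lambda>x. x \<bullet> y)"
proof -
  have "poly_fun_deg_le (1 + 0) (\<lambda>x. x $ i * y $ i)" for i
    by (intro poly_fun_deg_le_mult poly_fun_deg_le_coord poly_fun_deg_le_const)
  then show ?thesis unfolding inner_vec_def by (auto intro: poly_fun_deg_le_sum)
qed

lemma poly_fun_deg_le_power:
  "poly_fun_deg_le 1 p \<Longrightarrow> poly_fun_deg_le k (\<lambda>x. p x ^ k)"
proof (induction k)
  case 0
  show ?case by (simp add: poly_fun_deg_le_const)
next
  case (Suc k)
  then have "poly_fun_deg_le (1 + k) (\<lambda>x. p x * p x ^ k)"
    by (intro poly_fun_deg_le_mult) auto
  then show ?case by simp
qed

section \<open>Normalized surface measure and its rotation invariance\<close>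

lemma borel_measurable_radial [measurable]:
  "(\<lambda>x::real ^ 'n. x /\<^sub>R norm x) \<in> borel_measurable borel"
  by measurable

lemma sets_sphere_measure [simp, measurable_cong]: "sets sphere_measure = sets borel"
  and space_sphere_measure [simp]: "space sphere_measure = UNIV"
  by (simp_all add: sphere_measure_def)

lemma emeasure_lborel_unit_ball_neq_0: "emeasure lborel (ball (0::real ^ 'n) 1) \<noteq> 0"
  using content_ball_pos[of 1 "0::real ^ 'n"] by (auto simp: measure_def)

lemma prob_space_sphere_measure: "prob_space sphere_measure"
proof -
  interpret prob_space "uniform_measure lborel (ball (0::real ^ 'a) 1)"
    using emeasure_lborel_ball_finite[of "0::real ^ 'a" 1]
    by (intro prob_space_uniform_measure emeasure_lborel_unit_ball_neq_0) auto
  show ?thesis unfolding sphere_measure_def by (rule prob_space_distr) measurable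
qed

text \<open>Radial projection misses the sphere only at the origin, which it sends to 0 and which is
  a null set.\<close>

lemma AE_sphere_measure_norm: "AE x in sphere_measure. norm x = 1"
proof -
  have "AE x in uniform_measure lborel (ball (0::real ^ 'a) 1). norm (x /\<^sub>R norm x) = 1"
    using AE_lborel_singleton[of "0::real ^ 'a"]
    by (intro AE_uniform_measureI) auto
  then show ?thesis
    unfolding sphere_measure_def by (subst AE_distr_iff) (auto simp del: norm_scaleR)
qed

lemma integrable_sphere_measure:
  fixes f :: "real ^ 'n \<Rightarrow> real"
  assumes "continuous_on UNIV f"
  shows "integrable sphere_measure f"
proof -
  interpret prob_space "sphere_measure :: (real ^ 'n) measure" by (rule prob_space_sphere_measure)
  have "compact (f ` sphere 0 1)"
    by (intro compact_continuous_image continuous_on_subset[OF assms]) auto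
  then obtain B where B: "\<forall>y\<in>f ` sphere 0 1. norm y \<le> B"
    using compact_imp_bounded bounded_iff by metis
  show ?thesis
  proof (rule integrable_const_bound[of _ B])
    show "AE x in sphere_measure. norm (f x) \<le> B"
      using AE_sphere_measure_norm by eventually_elim (use B in auto)
    show "f \<in> borel_measurable sphere_measure"
      using borel_measurable_continuous_onI[OF assms] by simp
  qed
qed

text \<open>Boxes determine \<open>lborel\<close>. The preimage of a box is its image under
  \<open>inv f\<close>, which is orthogonal and hence preserves Lebesgue measure.\<close>

lemma lborel_distr_orthogonal:
  fixes f :: "real ^ 'n::{finite,wellorder} \<Rightarrow> real ^ 'n::_"
  assumes "orthogonal_transformation f"
  shows "distr lborel borel f = lborel"
proof (rule lborel_eqI[symmetric])
  fix l u :: "real ^ 'n::_"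
  assume lu: "\<And>b. b \<in> Basis \<Longrightarrow> l \<bullet> b \<le> u \<bullet> b"
  have f: "f \<in> borel_measurable borel"
    using assms by (intro borel_measurable_continuous_onI linear_continuous_on)
      (simp add: orthogonal_transformation_linear linear_conv_bounded_linear[symmetric])
  have bij: "bij f" using assms by (rule orthogonal_transformation_bij)
  have inv: "orthogonal_transformation (inv f)"
    using assms by (rule orthogonal_transformation_inv)
  have eq: "f -` box l u = inv f ` box l u" using bij by (simp add: bij_vimage_eq_inv_image)
  have "emeasure (distr lborel borel f) (box l u) = emeasure lborel (f -` box l u)"
    using f by (subst emeasure_distr) auto
  also have "\<dots> = emeasure lebesgue (inv f ` box l u)"
    using measurable_sets[OF f, of "box l u"] by (simp add: eq)
  also have "\<dots> = ennreal (measure lebesgue (inv f ` box l u))"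
    using measurable_orthogonal_image[OF inv lmeasurable_box[of l u]]
    by (intro emeasure_eq_measure2)
  also have "measure lebesgue (inv f ` box l u) = measure lebesgue (box l u)"
    by (intro measure_orthogonal_image inv) simp
  also have "ennreal \<dots> = (\<Prod>b\<in>Basis. (u - l) \<bullet> b)"
    using lu by (simp add: measure_lborel_box)
  finally show "emeasure (distr lborel borel f) (box l u) = (\<Prod>b\<in>Basis. (u - l) \<bullet> b)" .
qed simp

text \<open>An orthogonal map preserves the uniform measure on the ball and, being linear and
  norm-preserving, commutes with radial projection.\<close>

lemma sphere_measure_distr_orthogonal:
  fixes f :: "real ^ 'n::{finite,wellorder} \<Rightarrow> real ^ 'n::_"
  assumes f: "orthogonal_transformation f"
  shows "distr sphere_measure borel f = sphere_measure"
proof -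
  let ?U = "uniform_measure lborel (ball (0::real ^ 'n::_) 1)"
  have lin: "linear f" and norm: "norm (f x) = norm x" for x
    using f by (auto simp: orthogonal_transformation)
  have m[measurable]: "f \<in> borel_measurable borel"
    using lin by (intro borel_measurable_continuous_onI linear_continuous_on)
      (simp add: linear_conv_bounded_linear[symmetric])
  have U: "distr ?U borel f = ?U"
  proof (rule measure_eqI)
    fix A :: "(real ^ 'n::_) set" assume "A \<in> sets (distr ?U borel f)"
    then have A: "A \<in> sets borel" by simp
    have fA: "f -` A \<in> sets borel" using measurable_sets[OF m A] by simp
    have "emeasure lborel (ball 0 1 \<inter> f -` A) = emeasure lborel (f -` (ball 0 1 \<inter> A))"
      by (rule arg_cong[where f = "emeasure lborel"]) (auto simp: norm)
    also have "\<dots> = emeasure (distr lborel borel f) (ball 0 1 \<inter> A)"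
      using A by (subst emeasure_distr) auto
    also have "\<dots> = emeasure lborel (ball 0 1 \<inter> A)"
      by (simp add: lborel_distr_orthogonal[OF f])
    finally show "emeasure (distr ?U borel f) A = emeasure ?U A"
      using A fA by (simp add: emeasure_distr)
  qed simp
  have "distr sphere_measure borel f = distr ?U borel (f \<circ> (\<lambda>x. x /\<^sub>R norm x))"
    unfolding sphere_measure_def by (subst distr_distr) auto
  also have "f \<circ> (\<lambda>x. x /\<^sub>R norm x) = (\<lambda>x. x /\<^sub>R norm x) \<circ> f"
    using lin by (auto simp: linear_scale norm)
  also have "distr ?U borel \<dots> = distr (distr ?U borel f) borel (\<lambda>x. x /\<^sub>R norm x)"
    by (subst distr_distr) auto
  finally show ?thesis by (simp only: U sphere_measure_def)
qed

section \<open>Moments of the sphere\<close>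

definition sphere_moment :: "nat \<Rightarrow> real ^ 'n \<Rightarrow> real" where
  "sphere_moment k u = (\<integral>x. (x \<bullet> u) ^ k \<partial>sphere_measure)"

lemma sphere_moment_scale: "sphere_moment k (c *\<^sub>R u) = c ^ k * sphere_moment k u"
  by (simp add: sphere_moment_def power_mult_distrib)

text \<open>Some orthogonal map carries \<open>u\<close> to \<open>v\<close>, and the measure is
  invariant under it. Lengths other than 1 matter for \<open>sphere_moment_mixed\<close>.\<close>

lemma sphere_moment_norm_cong:
  fixes u v :: "real ^ 'n::{finite,wellorder}"
  assumes "norm u = norm v"
  shows "sphere_moment k u = sphere_moment k v"
proof -
  obtain f where f: "orthogonal_transformation f" "f u = v"
    using orthogonal_transformation_exists[OF assms] by blast
  have m[measurable]: "f \<in> borel_measurable borel"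
    using f by (intro borel_measurable_continuous_onI linear_continuous_on)
      (simp add: orthogonal_transformation_linear linear_conv_bounded_linear[symmetric])
  have "sphere_moment k v = (\<integral>x. (x \<bullet> f u) ^ k \<partial>distr sphere_measure borel f)"
    by (simp add: sphere_moment_def f sphere_measure_distr_orthogonal)
  also have "\<dots> = (\<integral>x. (f x \<bullet> f u) ^ k \<partial>sphere_measure)"
    by (rule integral_distr) auto
  also have "\<dots> = sphere_moment k u"
    using f(1) by (simp add: orthogonal_transformation_def sphere_moment_def)
  finally show ?thesis ..
qed

lemma sphere_moment_0 [simp]: "sphere_moment 0 u = 1"
  using prob_space.prob_space[OF prob_space_sphere_measure] by (simp add: sphere_moment_def)

text \<open>Replacing \<open>u\<close> by \<open>-u\<close> keeps the norm but flips the sign of an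
  odd moment.\<close>

lemma sphere_moment_odd:
  fixes u :: "real ^ 'n::{finite,wellorder}"
  assumes "odd k"
  shows "sphere_moment k u = 0"
  using sphere_moment_norm_cong[of "- u" u k] sphere_moment_scale[of k "-1" u] assms by simp

lemma coeff_one_plus_square_power:
  "coeff ([:1, 0, 1:] ^ j :: real poly) 0 = 1 \<and> coeff ([:1, 0, 1:] ^ j :: real poly) 2 = real j"
  by (induction j) (auto simp: coeff_pCons numeral_2_eq_2)

text \<open>Compare the coefficients of \<open>t\<^sup>2\<close> in
  \<open>\<integral>(x \<bullet> (u + t v))\<^bsup>2j\<^esup> d\<sigma> = (1 + t\<^sup>2)\<^sup>j \<integral>(x \<bullet> u)\<^bsup>2j\<^esup> d\<sigma>\<close> for \<open>2 j = k + 2\<close>.\<close>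
lemma sphere_moment_mixed:
  fixes u v :: "real ^ 'n::{finite,wellorder}"
  assumes "norm u = 1" "norm v = 1" "u \<bullet> v = 0" "even k"
  shows "real (k + 1) * (\<integral>x. (x \<bullet> v)\<^sup>2 * (x \<bullet> u) ^ k \<partial>sphere_measure) = sphere_moment (k + 2) u"
proof -
  obtain j where j: "k + 2 = 2 * j" "j > 0"
  proof
    show "k + 2 = 2 * (k div 2 + 1)" using assms(4) by simp
  qed simp
  define \<mu> where "\<mu> i = (\<integral>x. (x \<bullet> v) ^ i * (x \<bullet> u) ^ (k + 2 - i) \<partial>sphere_measure)" for i
  \<comment> \<open>Both sides as polynomials in \<open>t\<close>: \<open>P\<close> from the
    binomial theorem, \<open>Q\<close> because \<open>u + t v\<close> is as long as
    \<open>sqrt (1 + t^2) u\<close>.\<close>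
  define P where "P = (\<Sum>i\<le>k + 2. monom (real (k + 2 choose i) * \<mu> i) i)"
  define Q where "Q = smult (sphere_moment (k + 2) u) ([:1, 0, 1:] ^ j)"
  have "poly P t = poly Q t" for t
  proof -
    let ?w = "u + t *\<^sub>R v"
    have "(norm ?w)\<^sup>2 = 1 + t\<^sup>2"
      unfolding power2_norm_eq_inner
      using assms by (simp add: inner_add_left inner_add_right norm_eq_1 inner_commute[of v u] power2_eq_square)
    then have norm: "norm ?w = sqrt (1 + t\<^sup>2)" by (metis norm_ge_zero real_sqrt_unique)
    have "sphere_moment (k + 2) ?w = sphere_moment (k + 2) (sqrt (1 + t\<^sup>2) *\<^sub>R u)"
      by (rule sphere_moment_norm_cong) (simp add: norm assms)
    also have "\<dots> = (1 + t\<^sup>2) ^ j * sphere_moment (k + 2) u"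
      unfolding sphere_moment_scale j power_mult by (simp add: add_nonneg_nonneg)
    also have "\<dots> = poly Q t" by (simp add: Q_def power2_eq_square)
    finally have Q: "poly Q t = sphere_moment (k + 2) ?w" ..
    have "(x \<bullet> ?w) ^ (k + 2)
        = (\<Sum>i\<le>k + 2. (real (k + 2 choose i) * t ^ i) * ((x \<bullet> v) ^ i * (x \<bullet> u) ^ (k + 2 - i)))" for x
      unfolding inner_add_right inner_scaleR_right add.commute[of "x \<bullet> u"] binomial_ring
      by (simp add: power_mult_distrib mult_ac)
    then have "sphere_moment (k + 2) ?w = (\<Sum>i\<le>k + 2. (real (k + 2 choose i) * t ^ i) * \<mu> i)"
      unfolding sphere_moment_def \<mu>_def
      by (subst Bochner_Integration.integral_sum[symmetric] integral_mult_right_zero[symmetric])+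
         (auto intro!: integrable_sphere_measure continuous_intros)
    also have "\<dots> = poly P t"
      by (simp add: P_def poly_sum poly_monom mult_ac)
    finally show ?thesis using Q by simp
  qed
  then have "P = Q" by (metis poly_eq_poly_eq_iff ext)
  then have "coeff P 2 = coeff Q 2" by simp
  moreover have "coeff P 2 = real (k + 2 choose 2) * \<mu> 2"
    unfolding P_def by (simp add: coeff_sum choose_two flip: numeral_2_eq_2)
  moreover have "coeff Q 2 = real j * sphere_moment (k + 2) u"
    using coeff_one_plus_square_power[of j] by (simp add: Q_def)
  \<comment> \<open>Since \<open>k + 2 = 2 * j\<close>, a factor \<open>j\<close> appears on both
    sides and cancels, leaving \<open>k + 1\<close>.\<close>
  moreover have "real (k + 2 choose 2) = real j * real (k + 1)"
    using j by (simp add: choose_two)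
  ultimately show ?thesis using j(2) by (simp add: \<mu>_def)
qed

text \<open>Take \<open>u\<close> to be a coordinate axis and insert \<open>1 = sum x_i^2\<close>
  into the \<open>k\<close>-th moment. The axis itself contributes the moment of order
  \<open>k + 2\<close>, every other coordinate \<open>1 / (k + 1)\<close> of it by
  \<open>sphere_moment_mixed\<close>.\<close>

lemma sphere_moment_recurrence:
  fixes u :: "real ^ 'n::{finite,wellorder}"
  assumes "norm u = 1" "even k"
  shows "real (k + CARD('n)) * sphere_moment (k + 2) u = real (k + 1) * sphere_moment k u"
proof -
  fix a :: 'n
  let ?e = "\<lambda>i::'n. axis i (1::real)"
  have norm: "sphere_moment l u = sphere_moment l (?e a)" for l
    using assms by (intro sphere_moment_norm_cong) simp
  have int: "integrable sphere_measure (\<lambda>x. (x \<bullet> v)\<^sup>2 * (x \<bullet> w) ^ k)" for v w :: "real ^ 'n::_"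
    by (intro integrable_sphere_measure continuous_intros)
  have "sphere_moment k (?e a) = (\<integral>x. (\<Sum>i\<in>UNIV. (x \<bullet> ?e i)\<^sup>2 * (x \<bullet> ?e a) ^ k) \<partial>sphere_measure)"
    unfolding sphere_moment_def
  proof (rule integral_cong_AE)
    show "AE x in sphere_measure. (x \<bullet> ?e a) ^ k = (\<Sum>i\<in>UNIV. (x \<bullet> ?e i)\<^sup>2 * (x \<bullet> ?e a) ^ k)"
      using AE_sphere_measure_norm
    proof eventually_elim
      case (elim x)
      then have "(\<Sum>i\<in>UNIV. (x \<bullet> ?e i)\<^sup>2) = 1"
        by (simp add: inner_axis norm_eq_1 inner_vec_def[of x x] power2_eq_square)
      then show ?case by (simp add: sum_distrib_right[symmetric])
    qed
  qed measurable
  also have "\<dots> = (\<Sum>i\<in>UNIV. \<integral>x. (x \<bullet> ?e i)\<^sup>2 * (x \<bullet> ?e a) ^ k \<partial>sphere_measure)"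
    by (intro Bochner_Integration.integral_sum int)
  finally have "real (k + 1) * sphere_moment k (?e a)
      = (\<Sum>i\<in>UNIV. real (k + 1) * (\<integral>x. (x \<bullet> ?e i)\<^sup>2 * (x \<bullet> ?e a) ^ k \<partial>sphere_measure))"
    by (simp add: sum_distrib_left)
  also have "\<dots> = (\<Sum>i\<in>UNIV. (if i = a then real (k + 1) else 1) * sphere_moment (k + 2) (?e a))"
  proof (rule sum.cong)
    fix i :: 'n
    show "real (k + 1) * (\<integral>x. (x \<bullet> ?e i)\<^sup>2 * (x \<bullet> ?e a) ^ k \<partial>sphere_measure)
        = (if i = a then real (k + 1) else 1) * sphere_moment (k + 2) (?e a)"
    proof (cases "i = a")
      case True
      then show ?thesis by (simp add: sphere_moment_def power_add mult_ac power2_eq_square)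
    next
      case False
      then show ?thesis
        using sphere_moment_mixed[of "?e a" "?e i" k] assms by (simp add: inner_axis_axis)
    qed
  qed simp
  also have "\<dots> = real (k + CARD('n)) * sphere_moment (k + 2) (?e a)"
    by (subst sum_distrib_right[symmetric], subst sum.remove[of _ a]) (auto simp: of_nat_diff)
  finally show ?thesis by (simp add: norm)
qed

section \<open>Energies of polynomials on designs\<close>

lemma poly_altdef_le:
  fixes p :: "'a::comm_semiring_1 poly"
  assumes "degree p \<le> d"
  shows "poly p t = (\<Sum>k\<le>d. coeff p k * t ^ k)"
  unfolding poly_altdef using assms
  by (intro sum.mono_neutral_left) (auto simp: coeff_eq_0)

text \<open>The design integrates \<open>p (x . y)\<close> exactly, and the moments do not depend on
  the direction \<open>y\<close>; the reference vector \<open>u\<close> makes this independence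
  visible.\<close>

lemma spherical_design_sum_poly:
  fixes C :: "(real ^ 'n::{finite,wellorder}) set" and u y :: "real ^ 'n::_"
  assumes C: "spherical_design d C" and p: "degree p \<le> d" and "norm u = 1" "norm y = 1"
  shows "(\<Sum>x\<in>C. poly p (x \<bullet> y)) = real (card C) * (\<Sum>k\<le>d. coeff p k * sphere_moment k u)"
proof -
  have eq: "poly p t = (\<Sum>k\<le>d. coeff p k * t ^ k)" for t
    by (rule poly_altdef_le) (rule p)
  have "poly_fun_deg_le d (\<lambda>x. poly p (x \<bullet> y))"
    unfolding eq
  proof (rule poly_fun_deg_le_sum)
    fix k assume "k \<in> {..d}"
    moreover have "poly_fun_deg_le (0 + k) (\<lambda>x. coeff p k * (x \<bullet> y) ^ k)"
      by (intro poly_fun_deg_le_mult poly_fun_deg_le_const poly_fun_deg_le_power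
        poly_fun_deg_le_inner)
    ultimately show "poly_fun_deg_le d (\<lambda>x. coeff p k * (x \<bullet> y) ^ k)"
      by (auto intro: poly_fun_deg_le_mono)
  qed
  then have "(\<integral>x. poly p (x \<bullet> y) \<partial>sphere_measure) = (1 / real (card C)) * (\<Sum>x\<in>C. poly p (x \<bullet> y))"
    using C by (auto simp: spherical_design_def)
  moreover have "(\<integral>x. poly p (x \<bullet> y) \<partial>sphere_measure) = (\<Sum>k\<le>d. coeff p k * sphere_moment k y)"
    unfolding eq sphere_moment_def
    by (subst Bochner_Integration.integral_sum)
       (auto intro!: integrable_sphere_measure continuous_intros)
  moreover have "sphere_moment k y = sphere_moment k u" for k
    using assms(3,4) by (intro sphere_moment_norm_cong) (simp only:)
  ultimately have "(\<Sum>k\<le>d. coeff p k * sphere_moment k u)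
      = (1 / real (card C)) * (\<Sum>x\<in>C. poly p (x \<bullet> y))"
    by (simp only:)
  moreover have "card C \<noteq> 0"
    using C by (auto simp: spherical_design_def spherical_code_def)
  ultimately show ?thesis by simp
qed

text \<open>For each \<open>x\<close> the inner sum is the full design sum less the diagonal term
  \<open>p 1\<close>. It is the same for all \<open>x\<close>, so averaging changes nothing.\<close>

lemma h_energy_poly_design:
  fixes C :: "(real ^ 'n::{finite,wellorder}) set" and u :: "real ^ 'n::_"
  assumes C: "spherical_design d C" and p: "degree p \<le> d" and u: "norm u = 1"
  shows "h_energy (poly p) C
    = real (card C) * (\<Sum>k\<le>d. coeff p k * sphere_moment k u) - poly p 1"
proof -
  let ?I = "\<Sum>k\<le>d. coeff p k * sphere_moment k u"
  have norm: "norm x = 1" if "x \<in> C" for x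
    using C that by (auto simp: spherical_design_def spherical_code_def)
  have fin: "finite C" "card C \<noteq> 0"
    using C by (auto simp: spherical_design_def spherical_code_def)
  have "(\<Sum>y\<in>C - {x}. poly p (x \<bullet> y)) = real (card C) * ?I - poly p 1" if "x \<in> C" for x
  proof -
    have "(\<Sum>y\<in>C - {x}. poly p (x \<bullet> y)) = (\<Sum>y\<in>C. poly p (y \<bullet> x)) - poly p (x \<bullet> x)"
      using that fin by (simp add: sum_diff1 inner_commute)
    also have "x \<bullet> x = 1" using norm[OF that] by (simp add: norm_eq_1)
    finally show ?thesis
      using spherical_design_sum_poly[OF C p u norm[OF that]] by simp
  qed
  then show ?thesis using fin by (simp add: h_energy_def)
qed

lemma h_energy_mono:
  assumes "\<And>t. t \<in> inner_products C \<Longrightarrow> f t \<le> g t"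
  shows "h_energy f C \<le> h_energy g C"
  unfolding h_energy_def
  by (intro mult_left_mono sum_mono assms) (auto simp: inner_products_def)

section \<open>Dimension 48 and the energy bound\<close>

lemma sphere_moments_48:
  fixes u :: "real ^ 48"
  assumes "norm u = 1"
  shows "sphere_moment 2 u = 1 / 48" "sphere_moment 4 u = 1 / 800" "sphere_moment 6 u = 1 / 8320"
    "sphere_moment 8 u = 7 / 449280" "sphere_moment 10 u = 1 / 399360"
proof -
  \<comment> \<open>Successive factors \<open>(k + 1) / (k + 48)\<close>: 1/48, 3/50, 5/52, 7/54,
    9/56.\<close>
  note rec = sphere_moment_recurrence[OF assms]
  show m2: "sphere_moment 2 u = 1 / 48" using rec[of 0] by (simp flip: numeral_2_eq_2)
  show m4: "sphere_moment 4 u = 1 / 800" using rec[of 2] m2 by simp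
  show m6: "sphere_moment 6 u = 1 / 8320" using rec[of 4] m4 by simp
  show m8: "sphere_moment 8 u = 7 / 449280" using rec[of 6] m6 by simp
  show "sphere_moment 10 u = 1 / 399360" using rec[of 8] m8 by simp
qed

text \<open>The weights in \<open>E_star\<close> satisfy the identity of
  \<open>h_energy_poly_design\<close>; this is checked arithmetically on each monomial, with no
  lattice constructed. For degree 0 the weights add up to \<open>52416000 - 1\<close>; for odd
  degrees only the point -1 survives.\<close>

lemma E_star_poly:
  fixes p :: "real poly" and u :: "real ^ 48"
  assumes "degree p \<le> 11" "norm u = 1"
  shows "E_star (poly p) = 52416000 * (\<Sum>k\<le>11. coeff p k * sphere_moment k u) - poly p 1"
proof -
  have sum: "(\<Sum>k\<le>11. f k) = f 0 + f 1 + f 2 + f 3 + f 4 + f 5 + f 6 + f 7 + f 8 + f 9 + f 10 + f 11"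
    for f :: "nat \<Rightarrow> real"
    by (simp add: atMost_nat_numeral add_ac)
  have poly: "poly p t = (\<Sum>k\<le>11. coeff p k * t ^ k)" for t
    by (rule poly_altdef_le) (rule assms)
  have odd: "sphere_moment 1 u = 0" "sphere_moment 3 u = 0" "sphere_moment 5 u = 0"
    "sphere_moment 7 u = 0" "sphere_moment 9 u = 0" "sphere_moment 11 u = 0"
    by (rule sphere_moment_odd, simp)+
  show ?thesis
    unfolding E_star_def poly sum odd sphere_moments_48[OF assms(2)] sphere_moment_0
    by (simp add: power_divide)
qed

theorem theorem4p6:
  fixes h :: "real \<Rightarrow> real" and C :: "(real ^ 48) set"
  assumes "continuous_on {-1..1} h"
    and "\<forall>k<12. \<forall>t\<in>{-1<..<1}. (deriv ^^ k) h differentiable (at t)"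
    and "\<forall>t\<in>{-1<..<1}. (deriv ^^ 12) h t \<ge> 0"
    and "spherical_design 11 C"
    and "avoiding T1 C"
    and "card C = 52416000"
  shows "h_energy h C \<le> E_star h"
proof -
  \<comment> \<open>Simple nodes sit where a sign change of \<open>W\<close> does no harm: the ends
    of \<open>[-1, 1]\<close> and of the intervals of \<open>T1\<close>. The others are doubled. The
    9 + 3 = 12 conditions match design strength 11 and the derivative of order 12.\<close>
  define S D :: "real set" where "S = {-1, -1/2, -1/3, -1/6, 0, 1/6, 1/3, 1/2, 1}"
    and "D = {-1/2, 0, 1/2}"
  have card: "card S + card D = 12" by (simp add: S_def D_def)
  obtain H where H: "degree H < 12" "\<forall>x\<in>S. poly H x = h x" "\<forall>x\<in>D. poly (pderiv H) x = deriv h x"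
    using Hermite_poly_exists[of S D h "deriv h"] unfolding card by (auto simp: S_def D_def)
  define W where "W = (\<Prod>y\<in>S. [:-y, 1:]) * (\<Prod>y\<in>D. [:-y, 1:])"
  \<comment> \<open>In terms of \<open>t^2\<close>: leaving \<open>T1\<close> means
    \<open>t^2 <= 1/36\<close> or \<open>t^2 >= 1/9\<close>, so the last two factors agree in sign
    and \<open>t^2 - 1\<close> decides.\<close>
  have W: "poly W t = (t\<^sup>2 - 1) * (t * (t\<^sup>2 - 1/4))\<^sup>2 * ((t\<^sup>2 - 1/9) * (t\<^sup>2 - 1/36))" for t
    unfolding W_def S_def D_def by (simp add: field_simps power2_eq_square)
  have h_le_H: "h t \<le> poly H t" if t: "t \<in> {-1..1}" "t \<notin> T1" for t
  proof -
    have sq: "t\<^sup>2 \<le> c\<^sup>2 \<longleftrightarrow> \<bar>t\<bar> \<le> c" "c\<^sup>2 \<le> t\<^sup>2 \<longleftrightarrow> c \<le> \<bar>t\<bar>" if "c \<ge> 0" for c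
      using that by (auto simp: abs_le_square_iff[symmetric])
    have "\<bar>t\<bar> \<le> 1/6 \<or> 1/3 \<le> \<bar>t\<bar>" using t(2) by (auto simp: T1_def)
    then have "t\<^sup>2 \<le> 1/36 \<or> 1/9 \<le> t\<^sup>2" using sq(1)[of "1/6"] sq(2)[of "1/3"] by (simp add: power_divide)
    then have "(t\<^sup>2 - 1/9) * (t\<^sup>2 - 1/36) \<ge> 0"
      by (auto intro: mult_nonneg_nonneg mult_nonpos_nonpos)
    moreover have "t\<^sup>2 \<le> 1" using t(1) by (simp add: abs_square_le_1 abs_le_iff)
    ultimately have Wt: "poly W t \<le> 0"
      unfolding W by (intro mult_nonpos_nonneg) auto
    \<comment> \<open>The zeroth iterate is written out to match \<open>F 0\<close>.\<close>
    have "(deriv ^^ 0) h t \<le> poly H t"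
    proof (rule Hermite_interpolation_error[where F = "\<lambda>k. (deriv ^^ k) h" and n = 12])
      show "((deriv ^^ k) h has_real_derivative (deriv ^^ Suc k) h x) (at x)"
        if "k < 12" "x \<in> {-1<..<1}" for k x
        using assms(2) that DERIV_deriv_iff_real_differentiable by auto
      show "finite S" "S \<subseteq> {-1..1}" "D \<subseteq> S" "D \<subseteq> {-1<..<1}"
        by (auto simp: S_def D_def)
    qed (use t H card Wt W_def assms(1,3) in auto)
    then show ?thesis by simp
  qed
  have "h_energy h C \<le> h_energy (poly H) C"
  proof (rule h_energy_mono, rule h_le_H)
    fix t assume t: "t \<in> inner_products C"
    then obtain x y where "x \<in> C" "y \<in> C" "t = x \<bullet> y" by (auto simp: inner_products_def)
    moreover from this have "norm x = 1" "norm y = 1"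
      using assms(4) by (auto simp: spherical_design_def spherical_code_def)
    ultimately show "t \<in> {-1..1}"
      using Cauchy_Schwarz_ineq2[of x y] by (simp add: abs_le_iff)
    show "t \<notin> T1" using t assms(5) by (auto simp: avoiding_def)
  qed
  \<comment> \<open>Any unit vector serves; it only names the moments common to both energy
    formulas.\<close>
  also obtain u :: "real ^ 48" where u: "norm u = 1" using vector_choose_size[of 1] by auto
  have "h_energy (poly H) C = E_star (poly H)"
    using h_energy_poly_design[OF assms(4), of H u] E_star_poly[of H u] H(1) u assms(6)
    by simp
  also have "\<dots> = E_star h"
    using H(2) by (simp add: E_star_def S_def)
  finally show ?thesis .
qed

end
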